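(* Let $n=4$ and let $U,W$ be $4$-dimensional $\mathbb{F}_q$-subspaces of $V=\mathbb{F}_{q^4}^2$, and assume that $\mathbb{F}_q$ is the maximum field of linearity of $L_U$. Then $L_U=L_W$ if and only if $W=\lambda U$ or $W=\lambda U^{\perp}$ for some $\lambda\in\mathbb{F}_{q^4}^*$.
   Context: $L_X=\{\langle u\rangle_{\mathbb{F}_{q^n}}:u\in X\setminus\{0\}\}\subseteq\mathrm{PG}(1,q^n)$. The maximum field of linearity of $L$ is $\mathbb{F}_{q^e}$ with $e\mid n$ largest such that $L=L_X$ for some $\mathbb{F}_{q^e}$-subspace $X$. $U^\perp=\{v\in V:\mathbf b(u,v)=0\ \forall u\in U\}$ with respect to the $\mathbb{F}_q$-bilinear form $\mathbf b((x_1,y_1),(x_2,y_2))=Tr_{q^n|q}(x_1y_2-x_2y_1)$, where $Tr_{q^n|q}(x)=x+x^q+\dots+x^{q^{n-1}}$. *)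

theory Defs
  imports "HOL-Computational_Algebra.Primes"
begin

text \<open>The ambient field F_{q^n} is a finite field type 'a with CARD('a) = q^n.
  The subfield F_{q^e} (e dividing n) is the set of elements fixed by x |-> x^(q^e).
  V = F_{q^n}^2 is represented by pairs.\<close>

definition subfield_of :: "nat \<Rightarrow> 'a::{field,finite} set" where
  "subfield_of m = {x. x ^ m = x}"

definition vsmul :: "'a::field \<Rightarrow> 'a \<times> 'a \<Rightarrow> 'a \<times> 'a" where
  "vsmul c v = (c * fst v, c * snd v)"

definition vadd :: "'a::field \<times> 'a \<Rightarrow> 'a \<times> 'a \<Rightarrow> 'a \<times> 'a" where
  "vadd u v = (fst u + fst v, snd u + snd v)"

definition is_subspace_over :: "'a::field set \<Rightarrow> ('a \<times> 'a) set \<Rightarrow> bool" where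
  "is_subspace_over K X \<longleftrightarrow> (0, 0) \<in> X \<and> (\<forall>u\<in>X. \<forall>v\<in>X. vadd u v \<in> X)
     \<and> (\<forall>c\<in>K. \<forall>v\<in>X. vsmul c v \<in> X)"

definition lin_comb :: "(nat \<Rightarrow> 'a::field) \<Rightarrow> ('a \<times> 'a) list \<Rightarrow> 'a \<times> 'a" where
  "lin_comb c vs = ((\<Sum>i<length vs. c i * fst (vs ! i)), (\<Sum>i<length vs. c i * snd (vs ! i)))"

definition span_over :: "'a::field set \<Rightarrow> ('a \<times> 'a) list \<Rightarrow> ('a \<times> 'a) set" where
  "span_over K vs = {v. \<exists>c. (\<forall>i<length vs. c i \<in> K) \<and> v = lin_comb c vs}"

definition lin_indep_over :: "'a::field set \<Rightarrow> ('a \<times> 'a) list \<Rightarrow> bool" where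
  "lin_indep_over K vs \<longleftrightarrow> (\<forall>c. (\<forall>i<length vs. c i \<in> K) \<and> lin_comb c vs = (0, 0)
      \<longrightarrow> (\<forall>i<length vs. c i = 0))"

definition has_dim_over :: "'a::field set \<Rightarrow> ('a \<times> 'a) set \<Rightarrow> nat \<Rightarrow> bool" where
  "has_dim_over K X k \<longleftrightarrow> (\<exists>vs. length vs = k \<and> lin_indep_over K vs \<and> span_over K vs = X)"

definition proj_point :: "'a::field \<times> 'a \<Rightarrow> ('a \<times> 'a) set" where
  "proj_point u = {vsmul c u | c. True}"

definition linset :: "('a::field \<times> 'a) set \<Rightarrow> ('a \<times> 'a) set set" where
  "linset X = proj_point ` (X - {(0, 0)})"

definition max_lin_exp :: "nat \<Rightarrow> nat \<Rightarrow> ('a::{field,finite} \<times> 'a) set \<Rightarrow> nat" where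
  "max_lin_exp q n U = (GREATEST e. e dvd n \<and>
      (\<exists>X. is_subspace_over (subfield_of (q ^ e)) X \<and> linset X = linset U))"

definition trace_q :: "nat \<Rightarrow> nat \<Rightarrow> 'a::field \<Rightarrow> 'a" where
  "trace_q q n x = (\<Sum>i<n. x ^ (q ^ i))"

definition bform :: "nat \<Rightarrow> nat \<Rightarrow> 'a::field \<times> 'a \<Rightarrow> 'a \<times> 'a \<Rightarrow> 'a" where
  "bform q n u v = trace_q q n (fst u * snd v - fst v * snd u)"

definition perp :: "nat \<Rightarrow> nat \<Rightarrow> ('a::field \<times> 'a) set \<Rightarrow> ('a \<times> 'a) set" where
  "perp q n U = {v. \<forall>u\<in>U. bform q n u v = 0}"

definition scale_set :: "'a::field \<Rightarrow> ('a \<times> 'a) set \<Rightarrow> ('a \<times> 'a) set" where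
  "scale_set l U = vsmul l ` U"

end

theory Submission
  imports Defs "HOL-Computational_Algebra.Polynomial" "HOL-Library.FuncSet"
begin

text \<open>Since \<open>U\<close> has fewer than \<open>q\<^sup>4\<close> nonzero vectors, some point misses \<open>L\<^sub>U\<close>, and in suitable
  coordinates of determinant \<open>1\<close> both \<open>U\<close> and \<open>W\<close> are graphs of \<open>q\<close>-polynomials with coefficients
  \<open>a\<^sub>i\<close> and \<open>b\<^sub>i\<close>; passing to \<open>U\<^sup>\<bottom>\<close> takes the adjoint polynomial. All fibres of \<open>x \<mapsto> f x / x\<close> have
  size \<open>-1\<close> modulo the characteristic, so the power sums of \<open>f x / x\<close> over the nonzero \<open>x\<close> only
  depend on \<open>L\<^sub>U\<close>. With exponents \<open>1\<close>, \<open>1 + q\<close>, \<open>1 + q\<^sup>2\<close>, \<open>1 + q + q\<^sup>2\<close> they show that \<open>a\<^sub>0\<close>,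
  \<open>a\<^sub>1 * fr a\<^sub>3\<close> and \<open>a\<^sub>2 * fr (fr a\<^sub>2)\<close>, with \<open>fr x = x ^ q\<close>, as well as both the sum and the
  product of \<open>P = a\<^sub>1 * fr a\<^sub>1 * fr (fr a\<^sub>2)\<close> and \<open>Q = a\<^sub>2 * fr a\<^sub>3 * fr (fr a\<^sub>3)\<close> are invariants. So \<open>P\<close> and \<open>Q\<close> are either preserved or exchanged, and the adjoint exchanges them.
  If \<open>a\<^sub>2 = 0\<close>, the Dickson determinant plays the same role with the norms of \<open>a\<^sub>1\<close> and \<open>a\<^sub>3\<close> in place
  of \<open>P\<close> and \<open>Q\<close>. Once they are preserved, Hilbert 90 provides the scalar.\<close>

section \<open>Quartic extensions of finite fields\<close>

text \<open>Translation by \<open>k\<close> permutes \<open>K\<close>, so the sum of all elements of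
  \<open>K\<close> absorbs \<open>card K\<close> copies of \<open>k\<close>.\<close>

lemma of_nat_card_additive_subgroup:
  fixes K :: "'a::{field,finite} set"
  assumes "\<And>x y. x \<in> K \<Longrightarrow> y \<in> K \<Longrightarrow> x + y \<in> K"
    and "\<And>x y. x \<in> K \<Longrightarrow> y \<in> K \<Longrightarrow> x - y \<in> K"
    and "k \<in> K" "k \<noteq> 0"
  shows "of_nat (card K) = (0::'a)"
proof -
  have "(\<Sum>x\<in>K. x) = (\<Sum>x\<in>K. x + k)"
    by (rule sum.reindex_bij_witness[of _ "\<lambda>x. x + k" "\<lambda>x. x - k"]) (use assms in auto)
  also have "\<dots> = (\<Sum>x\<in>K. x) + of_nat (card K) * k"
    by (simp add: sum.distrib)
  finally show ?thesis
    using \<open>k \<noteq> 0\<close> by simp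
qed

lemma power_card_eq_self:
  fixes x :: "'a::{field,finite}"
  shows "x ^ card (UNIV :: 'a set) = x"
proof (cases "x = 0")
  case False
  let ?S = "- {0::'a}"
  have "(\<Prod>y\<in>?S. y) = (\<Prod>y\<in>?S. x * y)"
    by (rule prod.reindex_bij_witness[of _ "\<lambda>y. x * y" "\<lambda>y. y / x"]) (use False in auto)
  also have "\<dots> = x ^ card ?S * (\<Prod>y\<in>?S. y)"
    by (simp add: prod.distrib)
  finally have "x ^ card ?S = 1"
    by simp
  moreover have "card (UNIV :: 'a set) = Suc (card ?S)"
    using card_Suc_Diff1[of UNIV "0::'a"] by (simp add: Compl_eq_Diff_UNIV)
  ultimately show ?thesis
    by simp
qed (simp add: power_0_left)

text \<open>A vanishing combination is carried around the four cyclic positions: the carries \<open>w\<close> sum to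
  zero, and a negative carry would force all of them to be negative.\<close>

lemma cyclic_digits_zero:
  fixes q z0 z1 z2 z3 :: int
  assumes q: "q \<ge> 2" and dvd: "q ^ 4 - 1 dvd z0 + z1 * q + z2 * q\<^sup>2 + z3 * q ^ 3"
    and lb: "z0 \<ge> -1" "z1 \<ge> -1" "z2 \<ge> -1" "z3 \<ge> -1" and sum: "z0 + z1 + z2 + z3 = 0"
  shows "z0 = 0 \<and> z1 = 0 \<and> z2 = 0 \<and> z3 = 0"
proof -
  from dvd obtain w3 where w3: "z0 + z1 * q + z2 * q\<^sup>2 + z3 * q ^ 3 = (q ^ 4 - 1) * w3"
    by (auto simp: dvd_def)
  define w2 where "w2 = q * w3 - z3"
  define w1 where "w1 = q * w2 - z2"
  define w0 where "w0 = q * w1 - z1"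
  have z: "z3 = q * w3 - w2" "z2 = q * w2 - w1" "z1 = q * w1 - w0" "z0 = q * w0 - w3"
    using w3 by (simp_all add: w2_def w1_def w0_def algebra_simps power2_eq_square power3_eq_cube
        numeral_eq_Suc)
  have "(q - 1) * (w0 + w1 + w2 + w3) = 0"
    using sum unfolding z by (simp add: algebra_simps)
  then have w: "w0 + w1 + w2 + w3 = 0"
    using q by simp
  have neg: "v < 0" if "u < 0" "q * u - v \<ge> -1" for u v
  proof -
    have "q * u \<le> 2 * u"
      using q that by (intro mult_right_mono_neg) auto
    then show ?thesis
      using that by linarith
  qed
  have "w0 \<ge> 0 \<and> w1 \<ge> 0 \<and> w2 \<ge> 0 \<and> w3 \<ge> 0"
    using neg[of w0 w3] neg[of w3 w2] neg[of w2 w1] neg[of w1 w0] lb w unfolding z by linarith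
  then have "w0 = 0" "w1 = 0" "w2 = 0" "w3 = 0"
    using w by auto
  then show ?thesis
    using z by simp
qed

locale quartic_extension =
  fixes q :: nat and F :: "'a::{field,finite} itself"
  assumes prime_power: "\<exists>p k. prime p \<and> k > 0 \<and> q = p ^ k"
    and card_field: "card (UNIV :: 'a set) = q ^ 4"
begin

lemma q_ge_2: "q \<ge> 2"
proof -
  obtain p k where "prime p" "k > 0" "q = p ^ k"
    using prime_power by blast
  then have "p \<le> q"
    using self_le_power[of p k] prime_ge_1_nat by auto
  then show ?thesis
    using prime_ge_2_nat[OF \<open>prime p\<close>] by simp
qed

lemma q_less_powers: "1 < q" "q < q\<^sup>2" "q\<^sup>2 < q ^ 3" "q ^ 3 < q ^ 4" "q < q ^ 3" "1 < q ^ 4"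
  using q_ge_2 power_strict_increasing[of 1 2 q] power_strict_increasing[of 1 3 q]
    power_strict_increasing[of 0 4 q]
  by (auto intro: power_strict_increasing)

section \<open>The Frobenius map of the quartic extension\<close>

definition fr :: "'a \<Rightarrow> 'a" where
  "fr x = x ^ q"

lemma fr_add [simp]: "fr (x + y) = fr x + fr y"
proof -
  obtain p k where pk: "prime p" "q = p ^ k"
    using prime_power by blast
  \<comment> \<open>The characteristic is a prime dividing \<open>q ^ 4\<close>, hence the prime
    \<open>p\<close> below \<open>q\<close>, as the freshman's dream requires.\<close>
  have "of_nat (card (UNIV :: 'a set)) = (0::'a)"
    by (rule of_nat_card_additive_subgroup[of _ 1]) auto
  then have "CHAR('a) dvd p ^ (k * 4)"
    unfolding of_nat_eq_0_iff_char_dvd card_field pk power_mult .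
  moreover have "prime CHAR('a)"
    using finite_imp_CHAR_pos[where 'a='a] prime_CHAR_semidom[where 'a='a] by simp
  ultimately have "CHAR('a) = p"
    using pk(1) by (metis prime_dvd_power primes_dvd_imp_eq)
  then show ?thesis
    using freshmans_dream'[of q k x y] pk unfolding fr_def by simp
qed

lemma fr_mult [simp]: "fr (x * y) = fr x * fr y"
  by (simp add: fr_def power_mult_distrib)

lemma fr_0 [simp]: "fr 0 = 0"
  using q_ge_2 by (simp add: fr_def power_0_left)

lemma fr_1 [simp]: "fr 1 = 1"
  by (simp add: fr_def)

lemma fr_eq_0_iff [simp]: "fr x = 0 \<longleftrightarrow> x = 0"
  using q_ge_2 by (simp add: fr_def)

lemma fr_divide [simp]: "fr (x / y) = fr x / fr y"
  by (simp add: fr_def power_divide)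

lemma fr_uminus [simp]: "fr (- x) = - fr x"
proof -
  have "fr x + fr (- x) = 0"
    by (simp flip: fr_add)
  then show ?thesis
    by (simp add: add_eq_0_iff)
qed

lemma fr_diff [simp]: "fr (x - y) = fr x - fr y"
  using fr_add[of x "- y"] by simp

lemma power_q_powers:
  "x ^ q = fr x" "x ^ (q\<^sup>2) = fr (fr x)" "x ^ (q ^ 3) = fr (fr (fr x))"
  "x ^ (q ^ 4) = fr (fr (fr (fr x)))"
  by (simp_all add: fr_def power2_eq_square numeral_eq_Suc mult.assoc flip: power_mult)

lemma fr_fr_fr_fr [simp]: "fr (fr (fr (fr x))) = x"
  using power_card_eq_self[of x] by (simp add: card_field power_q_powers)

lemma fr_inj [simp]: "fr x = fr y \<longleftrightarrow> x = y"
  by (metis fr_fr_fr_fr)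

section \<open>Linearized polynomials of q-degree at most three\<close>

definition qp :: "'a \<Rightarrow> 'a \<Rightarrow> 'a \<Rightarrow> 'a \<Rightarrow> 'a \<Rightarrow> 'a" where
  "qp a0 a1 a2 a3 x = a0 * x + a1 * fr x + a2 * fr (fr x) + a3 * fr (fr (fr x))"

lemma qp_add: "qp a0 a1 a2 a3 (x + y) = qp a0 a1 a2 a3 x + qp a0 a1 a2 a3 y"
  by (simp add: qp_def algebra_simps)

lemma qp_diff: "qp a0 a1 a2 a3 (x - y) = qp a0 a1 a2 a3 x - qp a0 a1 a2 a3 y"
  by (simp add: qp_def algebra_simps)

lemma qp_0 [simp]: "qp a0 a1 a2 a3 0 = 0"
  by (simp add: qp_def)

text \<open>The fibre is the root set of a polynomial of degree at most \<open>q ^ 3\<close>; the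
  exponents are distinct and positive, so no coefficient merges with another or with
  \<open>- c\<close>.\<close>

lemma card_qp_fibre:
  assumes "\<not> (a0 = 0 \<and> a1 = 0 \<and> a2 = 0 \<and> a3 = 0)"
  shows "card {x. qp a0 a1 a2 a3 x = c} \<le> q ^ 3"
proof -
  define P where "P = monom a0 1 + monom a1 q + monom a2 (q\<^sup>2) + monom a3 (q ^ 3) + [:- c:]"
  have roots: "{x. qp a0 a1 a2 a3 x = c} = {x. poly P x = 0}"
    by (simp add: P_def qp_def poly_monom power_q_powers)
  have c: "coeff P 1 = a0" "coeff P q = a1" "coeff P (q\<^sup>2) = a2" "coeff P (q ^ 3) = a3"
    using q_less_powers by (auto simp: P_def coeff_pCons split: nat.splits)
  have "P \<noteq> 0"
    using assms c by (metis coeff_0)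
  moreover have "degree P \<le> q ^ 3"
    unfolding P_def using q_less_powers
    by (intro degree_add_le order.trans[OF degree_monom_le]) (auto simp: less_imp_le)
  ultimately show ?thesis
    using card_poly_roots_bound[of P] roots by simp
qed

lemma qp_eq_0_imp_coeffs_0:
  assumes "\<And>x. qp a0 a1 a2 a3 x = 0"
  shows "a0 = 0 \<and> a1 = 0 \<and> a2 = 0 \<and> a3 = 0"
proof (rule ccontr)
  assume "\<not> ?thesis"
  from card_qp_fibre[OF this, of 0] show False
    using assms q_less_powers by (simp add: card_field)
qed

section \<open>Trace form, adjoints and Hilbert 90\<close>

definition tr :: "'a \<Rightarrow> 'a" where
  "tr x = x + fr x + fr (fr x) + fr (fr (fr x))"

lemma trace_q_eq_tr: "trace_q q 4 x = tr x"
proof -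
  have "{..<4::nat} = {0, 1, 2, 3}"
    by auto
  then show ?thesis
    by (simp add: trace_q_def tr_def power_q_powers add.assoc)
qed

lemma tr_diff: "tr (x - y) = tr x - tr y"
  by (simp add: tr_def)

lemma fr_tr: "fr (tr x) = tr x"
  by (simp add: tr_def)

text \<open>As a function of \<open>x\<close> the trace is a q-polynomial whose coefficients are the
  conjugates of \<open>w\<close>.\<close>

lemma tr_nondegenerate:
  assumes "\<And>x. tr (x * w) = 0"
  shows "w = 0"
  using qp_eq_0_imp_coeffs_0[of w "fr w" "fr (fr w)" "fr (fr (fr w))"] assms
  by (simp add: tr_def qp_def mult.commute)

text \<open>The trace is unchanged by \<open>fr\<close>, so each term may be hit by the power of
  \<open>fr\<close> that turns the conjugate of \<open>x\<close> back into \<open>x\<close>.\<close>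

lemma tr_adjoint:
  "tr (y * qp a0 a1 a2 a3 x) = tr (x * qp a0 (fr a3) (fr (fr a2)) (fr (fr (fr a1))) y)"
proof -
  have "tr (y * qp a0 a1 a2 a3 x)
    = tr (y * (a0 * x)) + tr (y * (a1 * fr x)) + tr (y * (a2 * fr (fr x)))
      + tr (y * (a3 * fr (fr (fr x))))"
    by (simp add: tr_def qp_def algebra_simps)
  also have "tr (y * (a1 * fr x)) = tr (x * (fr (fr (fr a1)) * fr (fr (fr y))))"
    by (simp add: tr_def mult_ac add_ac)
  also have "tr (y * (a2 * fr (fr x))) = tr (x * (fr (fr a2) * fr (fr y)))"
    by (simp add: tr_def mult_ac add_ac)
  also have "tr (y * (a3 * fr (fr (fr x)))) = tr (x * (fr a3 * fr y))"
    by (simp add: tr_def mult_ac add_ac)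
  finally show ?thesis
    by (simp add: tr_def qp_def algebra_simps)
qed

lemma hilbert_90:
  assumes "d * fr d * fr (fr d) * fr (fr (fr d)) = 1"
  obtains l where "l \<noteq> 0" "d = l / fr l"
proof -
  \<comment> \<open>A Lagrange resolvent: its first coefficient is \<open>1\<close>, so it is not
    identically zero. Multiplying \<open>fr l\<close> by \<open>d\<close> shifts the terms
    cyclically, and norm \<open>1\<close> closes the cycle.\<close>
  obtain y where y: "qp 1 d (d * fr d) (d * fr d * fr (fr d)) y \<noteq> 0"
    using qp_eq_0_imp_coeffs_0[of 1 d "d * fr d" "d * fr d * fr (fr d)"] by auto
  define l where "l = qp 1 d (d * fr d) (d * fr d * fr (fr d)) y"
  have "d * fr l = d * fr y + d * fr d * fr (fr y) + d * fr d * fr (fr d) * fr (fr (fr y))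
      + d * fr d * fr (fr d) * fr (fr (fr d)) * y"
    by (simp add: l_def qp_def algebra_simps)
  also have "\<dots> = l"
    unfolding assms by (simp add: l_def qp_def)
  finally have "d * fr l = l" .
  then show ?thesis
    using that[of l] y unfolding l_def[symmetric] by (simp add: field_simps)
qed

end

section \<open>Power sums over the slopes\<close>

text \<open>One rule for each position of a three-term factor in a product of two or three factors,
  so that a single rewriting pass reaches sums of monomials.\<close>

lemma sum_expand:
  fixes c1 c2 c3 :: "'a::comm_ring_1"
  shows sum_expand_left: "(\<Sum>x\<in>S. (c1 * p1 x + c2 * p2 x + c3 * p3 x) * k x)
    = c1 * (\<Sum>x\<in>S. p1 x * k x) + c2 * (\<Sum>x\<in>S. p2 x * k x) + c3 * (\<Sum>x\<in>S. p3 x * k x)"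
    and sum_expand_right: "(\<Sum>x\<in>S. k x * (c1 * p1 x + c2 * p2 x + c3 * p3 x))
    = c1 * (\<Sum>x\<in>S. k x * p1 x) + c2 * (\<Sum>x\<in>S. k x * p2 x) + c3 * (\<Sum>x\<in>S. k x * p3 x)"
    and sum_expand_middle: "(\<Sum>x\<in>S. k x * ((c1 * p1 x + c2 * p2 x + c3 * p3 x) * l x))
    = c1 * (\<Sum>x\<in>S. k x * (p1 x * l x)) + c2 * (\<Sum>x\<in>S. k x * (p2 x * l x))
      + c3 * (\<Sum>x\<in>S. k x * (p3 x * l x))"
    and sum_expand_last: "(\<Sum>x\<in>S. k x * (l x * (c1 * p1 x + c2 * p2 x + c3 * p3 x)))
    = c1 * (\<Sum>x\<in>S. k x * (l x * p1 x)) + c2 * (\<Sum>x\<in>S. k x * (l x * p2 x))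
      + c3 * (\<Sum>x\<in>S. k x * (l x * p3 x))"
  by (simp_all add: sum_distrib_left sum.distrib algebra_simps)

section \<open>Monomial sums over the nonzero elements\<close>

context quartic_extension
begin

text \<open>Replacing \<open>x\<close> by \<open>g * x\<close> multiplies the sum by
  \<open>g powi m\<close>, so one \<open>g\<close> with \<open>g powi m \<noteq> 1\<close>
  suffices.\<close>

lemma sum_nonzero_power_int_eq_0:
  fixes m :: int
  assumes "\<not> int q ^ 4 - 1 dvd m"
  shows "(\<Sum>x\<in>- {0::'a}. x powi m) = 0"
proof -
  define N where "N = q ^ 4 - 1"
  have N: "N > 0" "int N = int q ^ 4 - 1"
    using q_less_powers by (simp_all add: N_def of_nat_diff)
  have card: "card (- {0::'a}) = N"
    by (simp add: N_def card_field[symmetric] Compl_eq_Diff_UNIV)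
  define r where "r = nat (m mod int N)"
  have "0 \<le> m mod int N" "m mod int N < int N" "m mod int N \<noteq> 0"
    using assms N(1) unfolding N(2)[symmetric] by (simp_all add: mod_eq_0_iff_dvd)
  then have r: "r > 0" "r < N" "m = int N * (m div int N) + int r"
    by (simp_all add: r_def nat_less_iff)
  \<comment> \<open>Otherwise \<open>monom 1 r - 1\<close> would have \<open>N\<close> roots, more
    than its degree \<open>r\<close>.\<close>
  have "\<exists>g::'a. g \<noteq> 0 \<and> g powi m \<noteq> 1"
  proof (rule ccontr)
    assume *: "\<not> ?thesis"
    have "g ^ r = 1" if "g \<noteq> 0" for g :: 'a
    proof -
      have "Suc N = card (UNIV :: 'a set)"
        using q_less_powers(6) by (simp add: N_def card_field)
      then have "g * g ^ N = g * 1"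
        using power_card_eq_self[of g] by (metis power_Suc mult.right_neutral)
      then have "g ^ N = 1"
        using that by simp
      moreover have "g powi m = (g ^ N) powi (m div int N) * g ^ r"
        using that by (subst r(3)) (simp add: power_int_add power_int_mult)
      ultimately show ?thesis
        using * that by (metis mult_1 power_int_1_left)
    qed
    then have "- {0} \<subseteq> {g::'a. poly (monom 1 r - 1) g = 0}"
      by (auto simp: poly_monom)
    moreover have "coeff (monom 1 r - 1 :: 'a poly) r = 1"
      using r by simp
    then have nz: "monom 1 r - 1 \<noteq> (0 :: 'a poly)"
      by (metis coeff_0 zero_neq_one)
    ultimately have "N \<le> card {g::'a. poly (monom 1 r - 1) g = 0}"
      unfolding card[symmetric] by (intro card_mono) auto
    also have "\<dots> \<le> degree (monom 1 r - 1 :: 'a poly)"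
      by (rule card_poly_roots_bound[OF nz])
    also have "\<dots> \<le> r"
      by (intro degree_diff_le degree_monom_le) simp
    finally show False
      using r by simp
  qed
  then obtain g :: 'a where g: "g \<noteq> 0" "g powi m \<noteq> 1"
    by blast
  have "(\<Sum>x\<in>- {0::'a}. x powi m) = (\<Sum>x\<in>- {0}. (g * x) powi m)"
    by (rule sum.reindex_bij_witness[of _ "\<lambda>x. g * x" "\<lambda>x. x / g"]) (use g in auto)
  also have "\<dots> = g powi m * (\<Sum>x\<in>- {0}. x powi m)"
    by (simp add: power_int_mult_distrib sum_distrib_left)
  finally show ?thesis
    using g by simp
qed

text \<open>A product of powers of the conjugates of \<open>x\<close>, one digit per conjugate;
  integer powers allow the digit \<open>-1\<close> that division produces.\<close>

definition mon :: "int \<Rightarrow> int \<Rightarrow> int \<Rightarrow> int \<Rightarrow> 'a \<Rightarrow> 'a" where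
  "mon z0 z1 z2 z3 x = x powi (z0 + z1 * int q + z2 * (int q)\<^sup>2 + z3 * int q ^ 3)"

lemma mon_mult:
  assumes "x \<noteq> 0"
  shows "mon z0 z1 z2 z3 x * mon y0 y1 y2 y3 x = mon (z0 + y0) (z1 + y1) (z2 + y2) (z3 + y3) x"
  using assms by (simp add: mon_def algebra_simps flip: power_int_add)

text \<open>By \<open>cyclic_digits_zero\<close> the exponent is a multiple of
  \<open>q ^ 4 - 1\<close> only if all digits vanish; then \<open>q ^ 4 - 1\<close> ones are added,
  which is \<open>-1\<close> in the field.\<close>

lemma sum_mon:
  assumes "z0 \<ge> -1" "z1 \<ge> -1" "z2 \<ge> -1" "z3 \<ge> -1" "z0 + z1 + z2 + z3 = 0"
  shows "(\<Sum>x\<in>- {0}. mon z0 z1 z2 z3 x) = (if z0 = 0 \<and> z1 = 0 \<and> z2 = 0 \<and> z3 = 0 then -1 else 0)"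
proof (cases "z0 = 0 \<and> z1 = 0 \<and> z2 = 0 \<and> z3 = 0")
  case True
  have "of_nat (card (UNIV :: 'a set)) = (0::'a)"
    by (rule of_nat_card_additive_subgroup[of _ 1]) auto
  moreover have "card (UNIV :: 'a set) = Suc (card (- {0::'a}))"
    using card_Suc_Diff1[of UNIV "0::'a"] by (simp add: Compl_eq_Diff_UNIV)
  ultimately have "of_nat (card (- {0::'a})) = (-1::'a)"
    by (simp add: eq_neg_iff_add_eq_0 add.commute)
  then show ?thesis
    using True by (simp add: mon_def)
next
  case False
  then have "\<not> int q ^ 4 - 1 dvd z0 + z1 * int q + z2 * (int q)\<^sup>2 + z3 * int q ^ 3"
    using cyclic_digits_zero[of "int q" z0 z1 z2 z3] assms q_ge_2 by auto
  then show ?thesis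
    using False sum_nonzero_power_int_eq_0 by (auto simp: mon_def)
qed

lemma sum_mon_mult:
  "(\<Sum>x\<in>- {0}. mon z0 z1 z2 z3 x * mon y0 y1 y2 y3 x)
    = (\<Sum>x\<in>- {0}. mon (z0 + y0) (z1 + y1) (z2 + y2) (z3 + y3) x)"
  "(\<Sum>x\<in>- {0}. mon z0 z1 z2 z3 x * (mon y0 y1 y2 y3 x * mon w0 w1 w2 w3 x))
    = (\<Sum>x\<in>- {0}. mon (z0 + y0 + w0) (z1 + y1 + w1) (z2 + y2 + w2) (z3 + y3 + w3) x)"
  by (rule sum.cong; simp add: mon_mult add.assoc)+

lemma fr_ratios_mon:
  assumes "x \<noteq> 0"
  shows "fr x / x = mon (-1) 1 0 0 x" "fr (fr x) / x = mon (-1) 0 1 0 x"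
    "fr (fr (fr x)) / x = mon (-1) 0 0 1 x"
    "fr (fr x) / fr x = mon 0 (-1) 1 0 x" "fr (fr (fr x)) / fr x = mon 0 (-1) 0 1 x"
    "x / fr x = mon 1 (-1) 0 0 x"
    "fr (fr (fr x)) / fr (fr x) = mon 0 0 (-1) 1 x" "x / fr (fr x) = mon 1 0 (-1) 0 x"
    "fr x / fr (fr x) = mon 0 1 (-1) 0 x"
proof -
  have e: "x = mon 1 0 0 0 x" "fr x = mon 0 1 0 0 x" "fr (fr x) = mon 0 0 1 0 x"
    "fr (fr (fr x)) = mon 0 0 0 1 x"
    unfolding mon_def by (simp_all flip: of_nat_power add: power_q_powers)
  have d: "mon z0 z1 z2 z3 x / mon y0 y1 y2 y3 x = mon (z0 - y0) (z1 - y1) (z2 - y2) (z3 - y3) x"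
    for z0 z1 z2 z3 y0 y1 y2 y3
    using assms by (simp add: mon_def algebra_simps flip: power_int_diff)
  show "fr x / x = mon (-1) 1 0 0 x" "fr (fr x) / x = mon (-1) 0 1 0 x"
    "fr (fr (fr x)) / x = mon (-1) 0 0 1 x"
    "fr (fr x) / fr x = mon 0 (-1) 1 0 x" "fr (fr (fr x)) / fr x = mon 0 (-1) 0 1 x"
    "x / fr x = mon 1 (-1) 0 0 x"
    "fr (fr (fr x)) / fr (fr x) = mon 0 0 (-1) 1 x" "x / fr (fr x) = mon 1 0 (-1) 0 x"
    "fr x / fr (fr x) = mon 0 1 (-1) 0 x"
    using d[of 1 0 0 0 0 1 0 0] d[of 1 0 0 0 0 0 1 0] d[of 0 1 0 0 1 0 0 0] d[of 0 1 0 0 0 0 1 0]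
      d[of 0 0 1 0 1 0 0 0] d[of 0 0 1 0 0 1 0 0] d[of 0 0 0 1 1 0 0 0] d[of 0 0 0 1 0 1 0 0]
      d[of 0 0 0 1 0 0 1 0]
    by (simp_all flip: e)
qed

section \<open>Slopes, the affine form of the points of a linear set\<close>

definition slopes :: "'a \<Rightarrow> 'a \<Rightarrow> 'a \<Rightarrow> 'a \<Rightarrow> 'a set" where
  "slopes a0 a1 a2 a3 = (\<lambda>x. qp a0 a1 a2 a3 x / x) ` (- {0})"

text \<open>Every fibre of \<open>x \<mapsto> qp x / x\<close>, completed by \<open>0\<close>, is a nontrivial additive group,
  so its size is \<open>-1\<close> in the field and the sum over \<open>x\<close> only depends on the set of slopes.\<close>

lemma sum_over_slopes:
  fixes h :: "'a \<Rightarrow> 'a"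
  shows "(\<Sum>x\<in>- {0}. h (qp a0 a1 a2 a3 x / x)) = - (\<Sum>d\<in>slopes a0 a1 a2 a3. h d)"
proof -
  have fibre: "(\<Sum>x\<in>{x\<in>- {0}. qp a0 a1 a2 a3 x / x = d}. h (qp a0 a1 a2 a3 x / x)) = - h d"
    if d: "d \<in> slopes a0 a1 a2 a3" for d
  proof -
    define K where "K = {x. qp a0 a1 a2 a3 x = d * x}"
    have split: "K = insert 0 {x\<in>- {0}. qp a0 a1 a2 a3 x / x = d}"
      by (auto simp: K_def field_simps)
    obtain x where "x \<noteq> 0" "d = qp a0 a1 a2 a3 x / x"
      using d by (auto simp: slopes_def)
    then have "x \<in> K" "x \<noteq> 0"
      by (simp_all add: K_def)
    then have "of_nat (card K) = (0::'a)"
      by (intro of_nat_card_additive_subgroup) (auto simp: K_def qp_add qp_diff algebra_simps)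
    then have card: "of_nat (card {x\<in>- {0}. qp a0 a1 a2 a3 x / x = d}) = (-1::'a)"
      unfolding split by (simp add: eq_neg_iff_add_eq_0 add.commute)
    have "(\<Sum>x\<in>{x\<in>- {0}. qp a0 a1 a2 a3 x / x = d}. h (qp a0 a1 a2 a3 x / x))
        = (\<Sum>x\<in>{x\<in>- {0}. qp a0 a1 a2 a3 x / x = d}. h d)"
      by (rule sum.cong) auto
    also have "\<dots> = - h d"
      by (simp only: sum_constant card) simp
    finally show ?thesis .
  qed
  have "(\<Sum>x\<in>- {0}. h (qp a0 a1 a2 a3 x / x))
    = (\<Sum>d\<in>slopes a0 a1 a2 a3. \<Sum>x\<in>{x\<in>- {0}. qp a0 a1 a2 a3 x / x = d}. h (qp a0 a1 a2 a3 x / x))"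
    unfolding slopes_def by (rule sum.image_gen) simp
  also have "\<dots> = - (\<Sum>d\<in>slopes a0 a1 a2 a3. h d)"
    using fibre by (simp add: sum_negf)
  finally show ?thesis .
qed

lemma qp_ratio:
  assumes "x \<noteq> 0"
  shows "qp a0 a1 a2 a3 x / x
    = a0 + a1 * mon (-1) 1 0 0 x + a2 * mon (-1) 0 1 0 x + a3 * mon (-1) 0 0 1 x"
  using assms by (simp add: qp_def add_divide_distrib flip: fr_ratios_mon)

lemma sum_qp_ratio: "(\<Sum>x\<in>- {0}. qp a0 a1 a2 a3 x / x) = - a0"
proof -
  have "(\<Sum>x\<in>- {0}. qp a0 a1 a2 a3 x / x) = (\<Sum>x\<in>- {0}. a0 * mon 0 0 0 0 x
     + a1 * mon (-1) 1 0 0 x + a2 * mon (-1) 0 1 0 x + a3 * mon (-1) 0 0 1 x)"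
    by (rule sum.cong) (auto simp: qp_ratio mon_def)
  then show ?thesis
    by (simp add: sum.distrib sum_mon flip: sum_distrib_left)
qed

context
  fixes a1 a2 a3 :: 'a
begin

text \<open>Each conjugate has the digit \<open>-1\<close> only in its own position, so products of
  distinct conjugates keep all digits at least \<open>-1\<close>, as \<open>sum_mon\<close>
  requires.\<close>

lemma qp_ratio_conjugates:
  assumes "x \<noteq> 0"
  shows "qp 0 a1 a2 a3 x / x
      = a1 * mon (-1) 1 0 0 x + a2 * mon (-1) 0 1 0 x + a3 * mon (-1) 0 0 1 x"
    and "fr (qp 0 a1 a2 a3 x / x)
      = fr a1 * mon 0 (-1) 1 0 x + fr a2 * mon 0 (-1) 0 1 x + fr a3 * mon 1 (-1) 0 0 x"
    and "fr (fr (qp 0 a1 a2 a3 x / x))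
      = fr (fr a1) * mon 0 0 (-1) 1 x + fr (fr a2) * mon 1 0 (-1) 0 x + fr (fr a3) * mon 0 1 (-1) 0 x"
  using assms by (simp_all add: qp_def add_divide_distrib flip: fr_ratios_mon)

text \<open>Of the nine products only that of \<open>a1\<close> and \<open>fr a3\<close> has
  cancelling digits.\<close>

lemma sum_ratio_q:
  "(\<Sum>x\<in>- {0}. qp 0 a1 a2 a3 x / x * fr (qp 0 a1 a2 a3 x / x)) = - (a1 * fr a3)"
proof -
  have "(\<Sum>x\<in>- {0}. qp 0 a1 a2 a3 x / x * fr (qp 0 a1 a2 a3 x / x))
    = (\<Sum>x\<in>- {0}.
        (a1 * mon (-1) 1 0 0 x + a2 * mon (-1) 0 1 0 x + a3 * mon (-1) 0 0 1 x)
      * (fr a1 * mon 0 (-1) 1 0 x + fr a2 * mon 0 (-1) 0 1 x + fr a3 * mon 1 (-1) 0 0 x))"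
    by (intro sum.cong refl arg_cong2[of _ _ _ _ "(*)"] qp_ratio_conjugates) auto
  also have "\<dots> = - (a1 * fr a3)"
    by (simp only: sum_expand_left sum_expand_right sum_mon_mult) (simp add: sum_mon)
  finally show ?thesis .
qed

lemma sum_ratio_q2:
  "(\<Sum>x\<in>- {0}. qp 0 a1 a2 a3 x / x * fr (fr (qp 0 a1 a2 a3 x / x))) = - (a2 * fr (fr a2))"
proof -
  have "(\<Sum>x\<in>- {0}. qp 0 a1 a2 a3 x / x * fr (fr (qp 0 a1 a2 a3 x / x)))
    = (\<Sum>x\<in>- {0}.
        (a1 * mon (-1) 1 0 0 x + a2 * mon (-1) 0 1 0 x + a3 * mon (-1) 0 0 1 x)
      * (fr (fr a1) * mon 0 0 (-1) 1 x + fr (fr a2) * mon 1 0 (-1) 0 x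
          + fr (fr a3) * mon 0 1 (-1) 0 x))"
    by (intro sum.cong refl arg_cong2[of _ _ _ _ "(*)"] qp_ratio_conjugates) auto
  also have "\<dots> = - (a2 * fr (fr a2))"
    by (simp only: sum_expand_left sum_expand_right sum_mon_mult) (simp add: sum_mon)
  finally show ?thesis .
qed

text \<open>Of the 27 products exactly two have cancelling digits, one for each summand on the
  right.\<close>

lemma sum_ratio_q_q2:
  "(\<Sum>x\<in>- {0}. qp 0 a1 a2 a3 x / x * (fr (qp 0 a1 a2 a3 x / x) * fr (fr (qp 0 a1 a2 a3 x / x))))
    = - (a1 * fr a1 * fr (fr a2) + a2 * fr a3 * fr (fr a3))"
proof -
  have "(\<Sum>x\<in>- {0}. qp 0 a1 a2 a3 x / x * (fr (qp 0 a1 a2 a3 x / x) * fr (fr (qp 0 a1 a2 a3 x / x))))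
    = (\<Sum>x\<in>- {0}.
        (a1 * mon (-1) 1 0 0 x + a2 * mon (-1) 0 1 0 x + a3 * mon (-1) 0 0 1 x)
      * ((fr a1 * mon 0 (-1) 1 0 x + fr a2 * mon 0 (-1) 0 1 x + fr a3 * mon 1 (-1) 0 0 x)
      * (fr (fr a1) * mon 0 0 (-1) 1 x + fr (fr a2) * mon 1 0 (-1) 0 x
          + fr (fr a3) * mon 0 1 (-1) 0 x)))"
    by (intro sum.cong refl arg_cong2[of _ _ _ _ "(*)"] qp_ratio_conjugates) auto
  also have "\<dots> = - (a1 * fr a1 * fr (fr a2) + a2 * fr a3 * fr (fr a3))"
    by (simp only: sum_expand_left sum_expand_right sum_expand_middle sum_expand_last
        sum_mon_mult) (simp add: sum_mon)
  finally show ?thesis .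
qed

end

end

section \<open>Recovering the coefficients\<close>

lemma eq_pair_of_sum_and_product:
  fixes p r p' r' :: "'a::field"
  assumes "p + r = p' + r'" "p * r = p' * r'"
  shows "p = p' \<and> r = r' \<or> p = r' \<and> r = p'"
proof -
  have "(p - p') * (p - r') = p * p - p * (p' + r') + p' * r'"
    by (simp add: algebra_simps)
  also have "\<dots> = 0"
    unfolding assms[symmetric] by (simp add: algebra_simps)
  finally show ?thesis
    using assms(1) by auto
qed

context quartic_extension
begin

lemma slope_invariants:
  assumes "slopes a0 a1 a2 a3 = slopes b0 b1 b2 b3"
  shows "a0 = b0" and "a1 * fr a3 = b1 * fr b3" and "a2 * fr (fr a2) = b2 * fr (fr b2)"
    and "a1 * fr a1 * fr (fr a2) + a2 * fr a3 * fr (fr a3)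
      = b1 * fr b1 * fr (fr b2) + b2 * fr b3 * fr (fr b3)"
proof -
  have sums: "(\<Sum>x\<in>- {0}. h (qp a0 a1 a2 a3 x / x)) = (\<Sum>x\<in>- {0}. h (qp b0 b1 b2 b3 x / x))"
    for h :: "'a \<Rightarrow> 'a"
    by (simp only: sum_over_slopes assms)
  show a0: "a0 = b0"
    using sums[of "\<lambda>d. d"] by (simp add: sum_qp_ratio)
  \<comment> \<open>Since \<open>a0 = b0\<close> is known, both slope sets may be shifted by the
    same amount, which removes this coefficient.\<close>
  have shift: "qp c c1 c2 c3 x / x - c = qp 0 c1 c2 c3 x / x" if "x \<noteq> 0" for c c1 c2 c3 x
    using that by (simp add: qp_def field_simps)
  have sums0: "(\<Sum>x\<in>- {0}. h (qp 0 a1 a2 a3 x / x)) = (\<Sum>x\<in>- {0}. h (qp 0 b1 b2 b3 x / x))"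
    for h :: "'a \<Rightarrow> 'a"
    using sums[of "\<lambda>d. h (d - a0)"] unfolding a0 by (simp add: shift)
  show "a1 * fr a3 = b1 * fr b3"
    using sums0[of "\<lambda>d. d * fr d"] unfolding sum_ratio_q by simp
  show "a2 * fr (fr a2) = b2 * fr (fr b2)"
    using sums0[of "\<lambda>d. d * fr (fr d)"] unfolding sum_ratio_q2 by simp
  show "a1 * fr a1 * fr (fr a2) + a2 * fr a3 * fr (fr a3)
      = b1 * fr b1 * fr (fr b2) + b2 * fr b3 * fr (fr b3)"
    using sums0[of "\<lambda>d. d * (fr d * fr (fr d))"] unfolding sum_ratio_q_q2
    by (simp only: neg_equal_iff_equal)
qed

section \<open>Norms and the case \<open>a2 = 0\<close>\<close>

definition nrm :: "'a \<Rightarrow> 'a" where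
  "nrm x = x * fr x * fr (fr x) * fr (fr (fr x))"

lemma nrm_divide: "nrm (x / y) = nrm x / nrm y"
  by (simp add: nrm_def)

lemma nrm_fr [simp]: "nrm (fr x) = nrm x"
  by (simp add: nrm_def mult_ac)

lemma nrm_eq_0_iff [simp]: "nrm x = 0 \<longleftrightarrow> x = 0"
  by (simp add: nrm_def)

text \<open>This is the vanishing of the determinant of the Dickson matrix of \<open>qp (-d) a1 0 a3\<close>;
  besides \<open>nrm a1 + nrm a3\<close> it only involves \<open>d\<close> and \<open>a1 * fr a3\<close>.\<close>

lemma dickson_determinant:
  assumes "x \<noteq> 0" and "d * x = a1 * fr x + a3 * fr (fr (fr x))" and p: "p = a1 * fr a3"
  shows "nrm a1 + nrm a3 = nrm d - p * fr (fr d) * fr (fr (fr d)) - fr p * d * fr (fr (fr d))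
    - fr (fr p) * d * fr d - fr (fr (fr p)) * fr d * fr (fr d) + p * fr (fr p) + fr p * fr (fr (fr p))"
proof -
  \<comment> \<open>With the conjugates named, the hypothesis and its conjugates form a cyclic
    homogeneous linear system in \<open>x\<close>, \<open>x1\<close>, \<open>x2\<close>,
    \<open>x3\<close>.\<close>
  define x1 x2 x3 where x: "x1 = fr x" "x2 = fr (fr x)" "x3 = fr (fr (fr x))"
  define d1 d2 d3 where d: "d1 = fr d" "d2 = fr (fr d)" "d3 = fr (fr (fr d))"
  define A1 A2 A3 where A: "A1 = fr a1" "A2 = fr (fr a1)" "A3 = fr (fr (fr a1))"
  define C1 C2 C3 where C: "C1 = fr a3" "C2 = fr (fr a3)" "C3 = fr (fr (fr a3))"
  have e0: "d * x = a1 * x1 + a3 * x3"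
    using assms by (simp add: x)
  have e1: "d1 * x1 = A1 * x2 + C1 * x"
    using arg_cong[OF assms(2), of fr] by (simp add: x A C d)
  have e2: "d2 * x2 = A2 * x3 + C2 * x1"
    using arg_cong[OF assms(2), of "\<lambda>x. fr (fr x)"] by (simp add: x A C d)
  have e3: "d3 * x3 = A3 * x + C3 * x2"
    using arg_cong[OF assms(2), of "\<lambda>x. fr (fr (fr x))"] by (simp add: x A C d)
  have nz: "x \<noteq> 0" "x1 \<noteq> 0" "x2 \<noteq> 0" "x3 \<noteq> 0"
    using assms(1) by (simp_all add: x)
  have "a1 * A1 * A2 * A3 + a3 * C1 * C2 * C3 = d * d1 * d2 * d3 - (a1 * C1) * d2 * d3
    - (A1 * C2) * d * d3 - (A2 * C3) * d * d1 - (A3 * a3) * d1 * d2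
    + (a1 * C1) * (A2 * C3) + (A1 * C2) * (A3 * a3)"
  proof (cases "d = 0")
    case True
    then have z: "d1 = 0" "d2 = 0" "d3 = 0"
      by (simp_all add: d)
    \<comment> \<open>The system splits into one for \<open>x1\<close>, \<open>x3\<close> and one
      for \<open>x\<close>, \<open>x2\<close>; the product of the two vanishing determinants is the
      claim.\<close>
    have "a1 * x1 = - (a3 * x3)" "A2 * x3 = - (C2 * x1)" "A1 * x2 = - (C1 * x)" "A3 * x = - (C3 * x2)"
      using e0 e1 e2 e3 True z by (simp_all add: eq_neg_iff_add_eq_0)
    then have "(a1 * x1) * (A2 * x3) = (a3 * x3) * (C2 * x1)"
      "(A1 * x2) * (A3 * x) = (C1 * x) * (C3 * x2)"
      by simp_all
    then have "(a1 * A2) * (x1 * x3) = (a3 * C2) * (x1 * x3)"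
      "(A1 * A3) * (x * x2) = (C1 * C3) * (x * x2)"
      by (simp_all only: mult_ac)
    then have "a1 * A2 = a3 * C2" "A1 * A3 = C1 * C3"
      using nz by simp_all
    then have "(a1 * A2 - a3 * C2) * (A1 * A3 - C1 * C3) = 0"
      by simp
    then show ?thesis
      using True z by (simp add: algebra_simps)
  next
    case False
    then have dnz: "d1 \<noteq> 0" "d3 \<noteq> 0"
      by (simp_all add: d)
    \<comment> \<open>Eliminating \<open>x1\<close> and \<open>x3\<close> leaves two relations
      between \<open>x\<close> and \<open>x2\<close>. In their product \<open>x * x2\<close>
      cancels, and then the surplus factor \<open>d1 * d3\<close>.\<close>
    have "x * (d * d1 * d3 - a1 * C1 * d3 - a3 * A3 * d1) = x2 * (a1 * A1 * d3 + a3 * C3 * d1)"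
      using e0 e1 e3 by algebra
    moreover have "x2 * (d1 * d2 * d3 - A2 * C3 * d1 - C2 * A1 * d3) = x * (A2 * A3 * d1 + C2 * C1 * d3)"
      using e1 e2 e3 by algebra
    ultimately have "(x * x2) * ((d * d1 * d3 - a1 * C1 * d3 - a3 * A3 * d1)
        * (d1 * d2 * d3 - A2 * C3 * d1 - C2 * A1 * d3))
      = (x * x2) * ((a1 * A1 * d3 + a3 * C3 * d1) * (A2 * A3 * d1 + C2 * C1 * d3))"
      by algebra
    then have "(d * d1 * d3 - a1 * C1 * d3 - a3 * A3 * d1)
        * (d1 * d2 * d3 - A2 * C3 * d1 - C2 * A1 * d3)
      = (a1 * A1 * d3 + a3 * C3 * d1) * (A2 * A3 * d1 + C2 * C1 * d3)"
      using nz by simp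
    then have "(d1 * d3) * (a1 * A1 * A2 * A3 + a3 * C1 * C2 * C3)
      = (d1 * d3) * (d * d1 * d2 * d3 - (a1 * C1) * d2 * d3
        - (A1 * C2) * d * d3 - (A2 * C3) * d * d1 - (A3 * a3) * d1 * d2
        + (a1 * C1) * (A2 * C3) + (A1 * C2) * (A3 * a3))"
      by algebra
    then show ?thesis
      using dnz by simp
  qed
  then show ?thesis
    by (simp add: nrm_def d A C p)
qed

text \<open>The slope at \<open>1\<close> is attained by both polynomials, and for equal
  \<open>d\<close> and equal \<open>a1 * fr a3\<close> the Dickson determinant gives equal norm
  sums.\<close>

lemma nrm_sum_invariant:
  assumes "slopes a0 a1 0 a3 = slopes a0 b1 0 b3" and "a1 * fr a3 = b1 * fr b3"
  shows "nrm a1 + nrm a3 = nrm b1 + nrm b3"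
proof -
  have "qp a0 a1 0 a3 1 / 1 \<in> slopes a0 a1 0 a3"
    unfolding slopes_def by (rule imageI) simp
  then obtain y where y: "y \<noteq> 0" "qp a0 a1 0 a3 1 / 1 = qp a0 b1 0 b3 y / y"
    unfolding assms by (auto simp: slopes_def)
  define d where "d = qp a0 a1 0 a3 1 - a0"
  have "d * 1 = a1 * fr 1 + a3 * fr (fr (fr 1))"
    by (simp add: d_def qp_def)
  moreover have "d * y = b1 * fr y + b3 * fr (fr (fr y))"
    using y by (simp add: d_def qp_def field_simps)
  ultimately show ?thesis
    using dickson_determinant[of 1 d a1 a3] dickson_determinant[of y d b1 b3] y assms(2) by simp
qed

text \<open>Scaling the graph by \<open>l\<close> changes the coefficients in this way. Hilbert 90
  reads \<open>l\<close> off from a quotient of norm \<open>1\<close>, and the invariants force the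
  other coefficients to follow.\<close>

lemma exists_scaling:
  assumes p: "a1 * fr a3 = b1 * fr b3" and n2: "a2 * fr (fr a2) = b2 * fr (fr b2)"
    and P: "a1 * fr a1 * fr (fr a2) = b1 * fr b1 * fr (fr b2)"
    and Q: "a2 * fr a3 * fr (fr a3) = b2 * fr b3 * fr (fr b3)"
    and N: "a2 = 0 \<Longrightarrow> nrm a1 = nrm b1 \<and> nrm a3 = nrm b3"
    and nz: "\<not> (a1 = 0 \<and> a3 = 0)"
  shows "\<exists>l. l \<noteq> 0 \<and> b1 = a1 * l / fr l \<and> b2 = a2 * l / fr (fr l) \<and> b3 = a3 * l / fr (fr (fr l))"
proof -
  have n13: "nrm a1 = nrm b1 \<and> nrm a3 = nrm b3"
  proof (cases "a2 = 0")
    case False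
    \<comment> \<open>Multiplying \<open>P\<close> or \<open>Q\<close> by its second conjugate
      isolates the norm of \<open>a1\<close> or \<open>a3\<close>.\<close>
    have "nrm a1 * (a2 * fr (fr a2)) = (a1 * fr a1 * fr (fr a2)) * fr (fr (a1 * fr a1 * fr (fr a2)))"
      by (simp add: nrm_def mult_ac)
    also have "\<dots> = nrm b1 * (a2 * fr (fr a2))"
      unfolding P n2 by (simp add: nrm_def mult_ac)
    finally have "nrm a1 = nrm b1"
      using False by simp
    have "nrm a3 * (a2 * fr (fr a2)) = (a2 * fr a3 * fr (fr a3)) * fr (fr (a2 * fr a3 * fr (fr a3)))"
      by (simp add: nrm_def mult_ac)
    also have "\<dots> = nrm b3 * (a2 * fr (fr a2))"
      unfolding Q n2 by (simp add: nrm_def mult_ac)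
    finally have "nrm a3 = nrm b3"
      using False by simp
    with \<open>nrm a1 = nrm b1\<close> show ?thesis by simp
  qed (use N in simp)
  then have b: "b1 = 0 \<longleftrightarrow> a1 = 0" "b3 = 0 \<longleftrightarrow> a3 = 0"
    using nrm_eq_0_iff by metis+
  show ?thesis
  proof (cases "a1 = 0")
    case False
    have "nrm (b1 / a1) = 1"
      using n13 False b by (simp add: nrm_divide)
    then obtain l where l: "l \<noteq> 0" "b1 / a1 = l / fr l"
      using hilbert_90[of "b1 / a1"] unfolding nrm_def by blast
    have b1: "b1 = a1 * l / fr l"
      using l False by (simp add: field_simps)
    have "fr a3 = l / fr l * fr b3"
      using p False l unfolding b1 by (simp add: field_simps)
    \<comment> \<open>Three more applications of \<open>fr\<close> undo the one on
      \<open>a3\<close>.\<close>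
    then have "fr (fr (fr (fr a3))) = fr (fr (fr (l / fr l * fr b3)))"
      by simp
    then have b3: "b3 = a3 * l / fr (fr (fr l))"
      using l by (simp add: field_simps)
    have "fr (fr a2) = l / fr (fr l) * fr (fr b2)"
      using P False l unfolding b1 by (simp add: field_simps)
    then have "fr (fr (fr (fr a2))) = fr (fr (l / fr (fr l) * fr (fr b2)))"
      by simp
    then have "b2 = a2 * l / fr (fr l)"
      using l by (simp add: field_simps)
    with l b1 b3 show ?thesis
      by blast
  next
    case True
    then have a3: "a3 \<noteq> 0" and b1: "b1 = 0"
      using nz b by auto
    \<comment> \<open>The quotient is inverted so that \<open>l = fr k\<close> satisfies
      \<open>fr (fr (fr l)) = k\<close>.\<close>
    have "nrm (a3 / b3) = 1"
      using n13 a3 b by (simp add: nrm_divide)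
    then obtain k where k: "k \<noteq> 0" "a3 / b3 = k / fr k"
      using hilbert_90[of "a3 / b3"] unfolding nrm_def by blast
    have b3: "b3 = a3 * fr k / k"
      using k a3 b by (simp add: field_simps)
    have "b2 = a2 * fr k / fr (fr (fr k))"
      using Q a3 k unfolding b3 by (simp add: field_simps)
    with k b1 b3 True show ?thesis
      by (intro exI[of _ "fr k"]) simp
  qed
qed

text \<open>The two alternatives are the coefficients of a multiple of the graph and of a multiple
  of its adjoint.\<close>

lemma coeffs_of_equal_slopes:
  assumes eq: "slopes a0 a1 a2 a3 = slopes b0 b1 b2 b3" and nz: "\<not> (a1 = 0 \<and> a3 = 0)"
  shows "a0 = b0 \<and> (\<exists>l. l \<noteq> 0 \<and>
    (b1 = a1 * l / fr l \<and> b2 = a2 * l / fr (fr l) \<and> b3 = a3 * l / fr (fr (fr l)) \<or>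
     b1 = fr a3 * l / fr l \<and> b2 = fr (fr a2) * l / fr (fr l)
       \<and> b3 = fr (fr (fr a1)) * l / fr (fr (fr l))))"
proof -
  note inv = slope_invariants[OF eq]
  \<comment> \<open>The product of the two summands in the last invariant is built from the other
    invariants, so the pair is known up to order.\<close>
  have "(a1 * fr a1 * fr (fr a2)) * (a2 * fr a3 * fr (fr a3))
      = (a1 * fr a3) * fr (a1 * fr a3) * (a2 * fr (fr a2))"
    by (simp add: mult_ac)
  also have "\<dots> = (b1 * fr b1 * fr (fr b2)) * (b2 * fr b3 * fr (fr b3))"
    unfolding inv by (simp add: mult_ac)
  finally have PQ: "a1 * fr a1 * fr (fr a2) = b1 * fr b1 * fr (fr b2)
        \<and> a2 * fr a3 * fr (fr a3) = b2 * fr b3 * fr (fr b3)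
      \<or> a1 * fr a1 * fr (fr a2) = b2 * fr b3 * fr (fr b3)
        \<and> a2 * fr a3 * fr (fr a3) = b1 * fr b1 * fr (fr b2)"
    by (rule eq_pair_of_sum_and_product[OF inv(4)])
  \<comment> \<open>Here both summands vanish and carry no information; the norms of
    \<open>a1\<close> and \<open>a3\<close> have a known sum and a known product instead.\<close>
  have N: "nrm a1 = nrm b1 \<and> nrm a3 = nrm b3 \<or> nrm a1 = nrm b3 \<and> nrm a3 = nrm b1" if "a2 = 0"
  proof (rule eq_pair_of_sum_and_product)
    have "b2 = 0"
      using inv(3) that by simp
    then have "slopes a0 a1 0 a3 = slopes a0 b1 0 b3"
      using eq unfolding that inv(1)[symmetric] by simp
    then show "nrm a1 + nrm a3 = nrm b1 + nrm b3"
      by (rule nrm_sum_invariant[OF _ inv(2)])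
    have "nrm (a1 * fr a3) = nrm (b1 * fr b3)"
      by (simp only: inv(2))
    then show "nrm a1 * nrm a3 = nrm b1 * nrm b3"
      by (simp add: nrm_def mult_ac)
  qed
  have direct: ?thesis if "a1 * fr a1 * fr (fr a2) = b1 * fr b1 * fr (fr b2)"
    "a2 * fr a3 * fr (fr a3) = b2 * fr b3 * fr (fr b3)"
    "a2 = 0 \<Longrightarrow> nrm a1 = nrm b1 \<and> nrm a3 = nrm b3"
    using exists_scaling[OF inv(2,3) that nz] inv(1) by blast
  have swapped: ?thesis if "a1 * fr a1 * fr (fr a2) = b2 * fr b3 * fr (fr b3)"
    "a2 * fr a3 * fr (fr a3) = b1 * fr b1 * fr (fr b2)"
    "a2 = 0 \<Longrightarrow> nrm a1 = nrm b3 \<and> nrm a3 = nrm b1"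
  proof -
    have "\<exists>l. l \<noteq> 0 \<and> b1 = fr a3 * l / fr l \<and> b2 = fr (fr a2) * l / fr (fr l)
        \<and> b3 = fr (fr (fr a1)) * l / fr (fr (fr l))"
    \<comment> \<open>For the adjoint coefficients the exchanged invariants match in order.\<close>
    proof (rule exists_scaling)
      show "fr a3 * fr (fr (fr (fr a1))) = b1 * fr b3"
        using inv(2) by (simp add: mult.commute)
      show "fr (fr a2) * fr (fr (fr (fr a2))) = b2 * fr (fr b2)"
        using inv(3) by (simp add: mult.commute)
      show "fr a3 * fr (fr a3) * fr (fr (fr (fr a2))) = b1 * fr b1 * fr (fr b2)"
        using that(2) by (simp add: mult_ac)
      show "fr (fr a2) * fr (fr (fr (fr a1))) * fr (fr (fr (fr (fr a1)))) = b2 * fr b3 * fr (fr b3)"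
        using that(1) by (simp add: mult_ac)
    qed (use nz that(3) in auto)
    then show ?thesis
      using inv(1) by blast
  qed
  show ?thesis
  proof (cases "a2 = 0")
    case True
    then have "b2 = 0"
      using inv(3) by simp
    from N[OF True] show ?thesis
    proof
      assume "nrm a1 = nrm b1 \<and> nrm a3 = nrm b3"
      then show ?thesis
        using True \<open>b2 = 0\<close> by (intro direct) simp_all
    next
      assume "nrm a1 = nrm b3 \<and> nrm a3 = nrm b1"
      then show ?thesis
        using True \<open>b2 = 0\<close> by (intro swapped) simp_all
    qed
  next
    case False
    with PQ show ?thesis
      using direct swapped by blast
  qed
qed

end

section \<open>Subspaces as graphs\<close>

lemma proj_point_vsmul: "c \<noteq> 0 \<Longrightarrow> proj_point (vsmul c u) = proj_point u"
proof -
  assume c: "c \<noteq> 0"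
  have "vsmul d u = vsmul (d / c) (vsmul c u)" for d
    using c by (simp add: vsmul_def)
  moreover have "vsmul d (vsmul c u) = vsmul (d * c) u" for d
    by (simp add: vsmul_def mult.assoc)
  ultimately show ?thesis
    unfolding proj_point_def by blast
qed

lemma linset_scale_set:
  assumes "l \<noteq> 0"
  shows "linset (scale_set l X) = linset X"
proof -
  have nz: "vsmul l v = (0, 0) \<longleftrightarrow> v = (0, 0)" for v
    using assms by (simp add: vsmul_def prod_eq_iff)
  have "scale_set l X - {(0, 0)} = vsmul l ` (X - {(0, 0)})"
  proof (intro equalityI subsetI)
    fix u
    assume "u \<in> scale_set l X - {(0, 0)}"
    then obtain v where "v \<in> X" "u = vsmul l v" "u \<noteq> (0, 0)"
      by (auto simp only: scale_set_def)
    then show "u \<in> vsmul l ` (X - {(0, 0)})"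
      using nz by simp
  next
    fix u
    assume "u \<in> vsmul l ` (X - {(0, 0)})"
    then obtain v where "v \<in> X" "u = vsmul l v" "v \<noteq> (0, 0)"
      by (auto simp only:)
    then show "u \<in> scale_set l X - {(0, 0)}"
      using nz by (simp add: scale_set_def)
  qed
  then show ?thesis
    using assms by (simp add: linset_def image_image proj_point_vsmul)
qed

context quartic_extension
begin

text \<open>A subspace missing the point \<open>\<langle>(1, m)\<rangle>\<close> is a graph with respect to the basis
  \<open>(0, 1)\<close>, \<open>(-1, -m)\<close> of determinant \<open>1\<close>.\<close>

definition qp_graph :: "'a \<Rightarrow> 'a \<Rightarrow> 'a \<Rightarrow> 'a \<Rightarrow> 'a \<Rightarrow> ('a \<times> 'a) set" where
  "qp_graph m a0 a1 a2 a3 = range (\<lambda>s. (- qp a0 a1 a2 a3 s, s - m * qp a0 a1 a2 a3 s))"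

lemma graph_iff:
  "(x, y) \<in> qp_graph m a0 a1 a2 a3 \<longleftrightarrow> - x = qp a0 a1 a2 a3 (y - m * x)"
proof
  assume "(x, y) \<in> qp_graph m a0 a1 a2 a3"
  then obtain s where "x = - qp a0 a1 a2 a3 s" "y = s - m * qp a0 a1 a2 a3 s"
    by (auto simp: qp_graph_def)
  then show "- x = qp a0 a1 a2 a3 (y - m * x)"
    by simp
next
  assume *: "- x = qp a0 a1 a2 a3 (y - m * x)"
  have "(x, y) = (- qp a0 a1 a2 a3 (y - m * x), (y - m * x) - m * qp a0 a1 a2 a3 (y - m * x))"
    unfolding *[symmetric] by simp
  then show "(x, y) \<in> qp_graph m a0 a1 a2 a3"
    unfolding qp_graph_def by (rule range_eqI)
qed

lemma linset_graph:
  "linset (qp_graph m a0 a1 a2 a3) = (\<lambda>d. proj_point (- d, 1 - m * d)) ` slopes a0 a1 a2 a3"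
proof -
  let ?v = "\<lambda>s. (- qp a0 a1 a2 a3 s, s - m * qp a0 a1 a2 a3 s)"
  have "qp_graph m a0 a1 a2 a3 - {(0, 0)} = ?v ` (- {0})"
    unfolding qp_graph_def by auto
  moreover have "proj_point (?v s) = proj_point (- (qp a0 a1 a2 a3 s / s), 1 - m * (qp a0 a1 a2 a3 s / s))"
    if "s \<noteq> 0" for s
  proof -
    have "?v s = vsmul s (- (qp a0 a1 a2 a3 s / s), 1 - m * (qp a0 a1 a2 a3 s / s))"
      using that by (simp add: vsmul_def field_simps)
    then show ?thesis
      using proj_point_vsmul[OF that] by simp
  qed
  ultimately show ?thesis
    unfolding linset_def slopes_def by (simp add: image_image)
qed

text \<open>A slope is an affine coordinate: \<open>(- d, 1 - m * d)\<close> is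
  \<open>(0, 1)\<close> plus \<open>d\<close> times \<open>(-1, -m)\<close>, so distinct slopes give
  distinct points.\<close>

lemma linset_graph_eq_iff:
  "linset (qp_graph m a0 a1 a2 a3) = linset (qp_graph m b0 b1 b2 b3)
    \<longleftrightarrow> slopes a0 a1 a2 a3 = slopes b0 b1 b2 b3"
proof -
  have "inj (\<lambda>d. proj_point (- d, 1 - m * d))"
  proof (rule injI)
    fix d e
    assume eq: "proj_point (- d, 1 - m * d) = proj_point (- e, 1 - m * e)"
    have "vsmul 1 (- d, 1 - m * d) \<in> proj_point (- d, 1 - m * d)"
      unfolding proj_point_def by blast
    then obtain c where "- d = c * (- e)" and c: "1 - m * d = c * (1 - m * e)"
      unfolding eq by (auto simp: proj_point_def vsmul_def)
    then have d: "d = c * e"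
      by simp
    with c have "c = 1"
      by (simp add: algebra_simps)
    with d show "d = e"
      by simp
  qed
  then show ?thesis
    unfolding linset_graph by (rule inj_image_eq_iff)
qed

text \<open>Reparametrising by \<open>l * s\<close> yields the graph of the map taking
  \<open>s\<close> to \<open>l\<close> times the value of the old q-polynomial at
  \<open>s / l\<close>.\<close>

lemma scale_set_graph:
  assumes "l \<noteq> 0"
  shows "scale_set l (qp_graph m a0 a1 a2 a3)
    = qp_graph m a0 (a1 * l / fr l) (a2 * l / fr (fr l)) (a3 * l / fr (fr (fr l)))"
proof -
  let ?L = "qp a0 a1 a2 a3"
  let ?M = "qp a0 (a1 * l / fr l) (a2 * l / fr (fr l)) (a3 * l / fr (fr (fr l)))"
  have M: "?M (l * s) = l * ?L s" for s
    using assms by (simp add: qp_def field_simps)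
  have "scale_set l (qp_graph m a0 a1 a2 a3) = range (\<lambda>s. (- ?M (l * s), l * s - m * ?M (l * s)))"
    unfolding M by (auto simp: scale_set_def qp_graph_def vsmul_def image_image algebra_simps)
  also have "\<dots> = (\<lambda>s. (- ?M s, s - m * ?M s)) ` range (\<lambda>s. l * s)"
    by (simp add: image_image)
  also have "range (\<lambda>s. l * s) = UNIV"
    by (rule surjI[of _ "\<lambda>s. s / l"]) (use assms in simp)
  finally show ?thesis
    by (simp add: qp_graph_def)
qed

text \<open>As the basis has determinant \<open>1\<close>, the form becomes
  \<open>tr (u * w)\<close>, where \<open>w\<close> measures how far \<open>(x, y)\<close> is from
  the adjoint graph; nondegeneracy forces \<open>w = 0\<close>.\<close>

lemma perp_graph:
  "perp q 4 (qp_graph m a0 a1 a2 a3) = qp_graph m a0 (fr a3) (fr (fr a2)) (fr (fr (fr a1)))"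
proof -
  let ?A = "qp a0 (fr a3) (fr (fr a2)) (fr (fr (fr a1)))"
  have b: "bform q 4 (- qp a0 a1 a2 a3 u, u - m * qp a0 a1 a2 a3 u) (x, y)
    = tr (u * (- x - ?A (y - m * x)))" for u x y
  proof -
    have "bform q 4 (- qp a0 a1 a2 a3 u, u - m * qp a0 a1 a2 a3 u) (x, y)
      = tr (u * (- x) - (y - m * x) * qp a0 a1 a2 a3 u)"
      unfolding bform_def trace_q_eq_tr by (rule arg_cong[of _ _ tr]) (simp add: algebra_simps)
    also have "\<dots> = tr (u * (- x)) - tr (u * ?A (y - m * x))"
      by (simp only: tr_diff tr_adjoint[of "y - m * x" a0 a1 a2 a3 u])
    also have "\<dots> = tr (u * (- x - ?A (y - m * x)))"
      unfolding right_diff_distrib[of u] tr_diff ..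
    finally show ?thesis .
  qed
  have "(\<forall>u. tr (u * w) = 0) \<longleftrightarrow> w = 0" for w
    using tr_nondegenerate[of w] by (auto simp: tr_def)
  then have "(x, y) \<in> perp q 4 (qp_graph m a0 a1 a2 a3)
    \<longleftrightarrow> (x, y) \<in> qp_graph m a0 (fr a3) (fr (fr a2)) (fr (fr (fr a1)))" for x y
    unfolding graph_iff by (simp add: perp_def qp_graph_def b)
  then show ?thesis
    by auto
qed

text \<open>If \<open>d\<close> is not a slope, subtracting \<open>d\<close> from \<open>a0\<close>
  gives an injective, hence surjective map. A kernel vector of its adjoint is trace-orthogonal to
  the image, so it is zero.\<close>

lemma slopes_adjoint_subset:
  "slopes a0 (fr a3) (fr (fr a2)) (fr (fr (fr a1))) \<subseteq> slopes a0 a1 a2 a3"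
proof
  fix d
  assume "d \<in> slopes a0 (fr a3) (fr (fr a2)) (fr (fr (fr a1)))"
  then obtain y where y: "y \<noteq> 0" "d = qp a0 (fr a3) (fr (fr a2)) (fr (fr (fr a1))) y / y"
    by (auto simp: slopes_def)
  then have y0: "qp (a0 - d) (fr a3) (fr (fr a2)) (fr (fr (fr a1))) y = 0"
    by (simp add: qp_def field_simps)
  show "d \<in> slopes a0 a1 a2 a3"
  proof (rule ccontr)
    assume "d \<notin> slopes a0 a1 a2 a3"
    then have "qp a0 a1 a2 a3 x / x \<noteq> d" if "x \<noteq> 0" for x
      using that by (auto simp: slopes_def)
    then have "qp (a0 - d) a1 a2 a3 x \<noteq> 0" if "x \<noteq> 0" for x
      using that by (fastforce simp: qp_def field_simps)
    then have "inj (qp (a0 - d) a1 a2 a3)"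
      by (intro injI) (metis qp_diff right_minus_eq)
    then have "surj (qp (a0 - d) a1 a2 a3)"
      by (simp add: finite_UNIV_inj_surj)
    moreover have "tr (y * qp (a0 - d) a1 a2 a3 x) = 0" for x
      using tr_adjoint[of y "a0 - d" a1 a2 a3 x] y0 by (simp add: tr_def)
    ultimately have "tr (w * y) = 0" for w
      by (metis mult.commute surjD)
    then show False
      using tr_nondegenerate y by blast
  qed
qed

lemma slopes_adjoint: "slopes a0 (fr a3) (fr (fr a2)) (fr (fr (fr a1))) = slopes a0 a1 a2 a3"
  using slopes_adjoint_subset[of a0 a3 a2 a1]
    slopes_adjoint_subset[of a0 "fr (fr (fr a1))" "fr (fr a2)" "fr a3"]
  by simp

text \<open>Only even powers of \<open>fr\<close> occur, and they fix the scalars. This is the case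
  ruled out by the maximum field of linearity.\<close>

lemma graph_subspace_q2:
  "is_subspace_over (subfield_of (q\<^sup>2)) (qp_graph m a0 0 a2 0)"
  unfolding is_subspace_over_def
proof (intro conjI ballI)
  fix u v
  assume "u \<in> qp_graph m a0 0 a2 0" "v \<in> qp_graph m a0 0 a2 0"
  then have "- fst u + - fst v = qp a0 0 a2 0 (snd u - m * fst u) + qp a0 0 a2 0 (snd v - m * fst v)"
    by (cases u; cases v) (simp add: graph_iff)
  also have "\<dots> = qp a0 0 a2 0 (snd u + snd v - m * (fst u + fst v))"
    unfolding qp_add[symmetric] by (simp add: algebra_simps)
  finally show "vadd u v \<in> qp_graph m a0 0 a2 0"
    by (simp add: vadd_def graph_iff)
next
  fix c :: 'a and v
  assume "c \<in> subfield_of (q\<^sup>2)" and v: "v \<in> qp_graph m a0 0 a2 0"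
  then have c: "fr (fr c) = c"
    by (simp add: subfield_of_def power_q_powers)
  obtain x y where xy: "v = (x, y)"
    by (cases v)
  have "- (c * x) = c * qp a0 0 a2 0 (y - m * x)"
    using v unfolding xy graph_iff by (metis mult_minus_right)
  also have "\<dots> = qp a0 0 a2 0 (c * y - m * (c * x))"
    using c by (simp add: qp_def algebra_simps)
  finally show "vsmul c v \<in> qp_graph m a0 0 a2 0"
    by (simp add: xy vsmul_def graph_iff)
qed (simp add: graph_iff)

section \<open>Graph coordinates for a four-dimensional subspace\<close>

lemma mem_subfield_iff: "c \<in> subfield_of q \<longleftrightarrow> fr c = c"
  by (simp add: subfield_of_def fr_def)

lemma qp_linear_combination:
  assumes "\<And>i. i \<in> I \<Longrightarrow> fr (c i) = c i"
  shows "qp a0 a1 a2 a3 (\<Sum>i\<in>I. c i * e i) = (\<Sum>i\<in>I. c i * qp a0 a1 a2 a3 (e i))"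
proof -
  have "qp a0 a1 a2 a3 (c i * e i) = c i * qp a0 a1 a2 a3 (e i)" if "i \<in> I" for i
    using assms[OF that] by (simp add: qp_def algebra_simps)
  moreover have "qp a0 a1 a2 a3 (\<Sum>i\<in>I. c i * e i) = (\<Sum>i\<in>I. qp a0 a1 a2 a3 (c i * e i))"
    by (induction I rule: infinite_finite_induct) (simp_all add: qp_add)
  ultimately show ?thesis
    by simp
qed

text \<open>Root counting bounds the size above. Below, the trace maps all \<open>q ^ 4\<close>
  elements into the subfield with fibres of size at most \<open>q ^ 3\<close>.\<close>

lemma card_subfield: "card (subfield_of q :: 'a set) = q"
proof (rule antisym)
  define P :: "'a poly" where "P = monom 1 q - monom 1 1"
  have "coeff P q = 1"
    using q_ge_2 by (simp add: P_def)
  then have "P \<noteq> 0"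
    by auto
  moreover have "degree P \<le> q"
    unfolding P_def using q_ge_2 by (intro degree_diff_le order.trans[OF degree_monom_le]) auto
  moreover have "subfield_of q = {x. poly P x = 0}"
    by (simp add: subfield_of_def P_def poly_monom)
  ultimately show "card (subfield_of q :: 'a set) \<le> q"
    using card_poly_roots_bound[of P] by simp
next
  have "q ^ 4 = card (\<Union>c\<in>subfield_of q. {x. tr x = c})"
    unfolding card_field[symmetric]
    by (rule arg_cong[of _ _ card]) (auto simp: mem_subfield_iff fr_tr)
  also have "\<dots> \<le> (\<Sum>c\<in>subfield_of q. card {x. tr x = c})"
    by (rule card_UN_le) simp
  also have "\<dots> \<le> (\<Sum>c\<in>(subfield_of q :: 'a set). q ^ 3)"
    using card_qp_fibre[of 1 1 1 1] by (intro sum_mono) (simp add: qp_def tr_def)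
  finally have "q * q ^ 3 \<le> card (subfield_of q :: 'a set) * q ^ 3"
    by (simp add: numeral_eq_Suc)
  then show "q \<le> card (subfield_of q :: 'a set)"
    using q_ge_2 by simp
qed

text \<open>There are \<open>q ^ 4\<close> points \<open>(1, m)\<close>, but \<open>U\<close> has at
  most \<open>q ^ 4\<close> vectors and one of them is zero.\<close>

lemma exists_point_not_in_linset:
  fixes U :: "('a \<times> 'a) set"
  assumes "has_dim_over (subfield_of q) U 4"
  shows "\<exists>m. proj_point (1, m) \<notin> linset U"
proof (rule ccontr)
  assume "\<not> ?thesis"
  then have sub: "range (\<lambda>m. proj_point (1, m)) \<subseteq> linset U"
    by blast
  have inj: "inj (\<lambda>m::'a. proj_point (1, m))"
  proof (rule injI)
    fix m m' :: 'a
    assume eq: "proj_point (1, m) = proj_point (1, m')"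
    have "vsmul 1 (1, m) \<in> proj_point (1, m)"
      unfolding proj_point_def by blast
    then show "m = m'"
      unfolding eq by (auto simp: proj_point_def vsmul_def)
  qed
  obtain vs where vs: "length vs = 4" "span_over (subfield_of q) vs = U"
    using assms unfolding has_dim_over_def by blast
  let ?C = "{..<4::nat} \<rightarrow>\<^sub>E (subfield_of q :: 'a set)"
  have "U \<subseteq> (\<lambda>c. lin_comb c vs) ` ?C"
  proof
    fix v
    assume "v \<in> U"
    then obtain c where c: "\<forall>i<4. c i \<in> subfield_of q" "v = lin_comb c vs"
      using vs by (auto simp: span_over_def)
    then have "v = lin_comb (restrict c {..<4}) vs" "restrict c {..<4} \<in> ?C"
      using vs by (auto simp: lin_comb_def)
    then show "v \<in> (\<lambda>c. lin_comb c vs) ` ?C"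
      by blast
  qed
  then have "card U \<le> card ((\<lambda>c. lin_comb c vs) ` ?C)"
    by (intro card_mono finite_imageI finite_PiE) auto
  also have "\<dots> \<le> card ?C"
    by (intro card_image_le finite_PiE) auto
  also have "\<dots> = q ^ 4"
    by (simp add: card_PiE card_subfield)
  finally have U: "card U \<le> q ^ 4" .
  have "lin_comb (\<lambda>_. 0) vs \<in> span_over (subfield_of q) vs"
    unfolding span_over_def by (intro CollectI exI[of _ "\<lambda>_. 0"]) (simp add: mem_subfield_iff)
  then have 0: "(0, 0) \<in> U"
    using vs by (simp add: lin_comb_def)
  have "q ^ 4 = card (range (\<lambda>m::'a. proj_point (1, m)))"
    by (simp add: card_image[OF inj] card_field)
  also have "\<dots> \<le> card (linset U)"
    using sub by (intro card_mono) auto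
  also have "\<dots> \<le> card (U - {(0, 0)})"
    unfolding linset_def by (rule card_image_le) simp
  also have "\<dots> < card U"
    using 0 by (intro psubset_card_mono) auto
  finally show False
    using U by simp
qed

text \<open>The map from \<open>v\<close> to \<open>snd v - m * fst v\<close> has kernel the point
  \<open>(1, m)\<close>, so it is injective on \<open>U\<close>, and by counting bijective onto the
  field.\<close>

lemma subspace_is_graph:
  assumes "has_dim_over (subfield_of q) U 4" and m: "proj_point (1, m) \<notin> linset U"
  shows "\<exists>a0 a1 a2 a3. U = qp_graph m a0 a1 a2 a3"
proof -
  obtain vs where len: "length vs = 4" and indep: "lin_indep_over (subfield_of q) vs"
    and span: "span_over (subfield_of q) vs = U"
    using assms unfolding has_dim_over_def by blast
  define e where "e i = snd (vs ! i) - m * fst (vs ! i)" for i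
  let ?C = "{..<4::nat} \<rightarrow>\<^sub>E (subfield_of q :: 'a set)"
  have lc: "snd (lin_comb c vs) - m * fst (lin_comb c vs) = (\<Sum>i<4. c i * e i)" for c
    by (simp add: lin_comb_def len e_def sum_distrib_left algebra_simps flip: sum_subtractf)
  have inj: "inj_on (\<lambda>c. \<Sum>i<4. c i * e i) ?C"
  proof (rule inj_onI)
    fix c d
    assume c: "c \<in> ?C" and d: "d \<in> ?C" and eq: "(\<Sum>i<4. c i * e i) = (\<Sum>i<4. d i * e i)"
    define v where "v = lin_comb (\<lambda>i. c i - d i) vs"
    have mem: "\<forall>i<length vs. c i - d i \<in> subfield_of q"
      using c d len by (auto simp: mem_subfield_iff PiE_iff)
    then have "v \<in> U"
      unfolding span[symmetric] span_over_def v_def by (intro CollectI exI[of _ "\<lambda>i. c i - d i"]) simp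
    have "snd v - m * fst v = (\<Sum>i<4. (c i - d i) * e i)"
      unfolding v_def by (rule lc)
    also have "\<dots> = 0"
      using eq by (simp add: algebra_simps sum_subtractf)
    finally have v: "v = vsmul (fst v) (1, m)"
      by (simp add: vsmul_def prod_eq_iff mult.commute)
    have "v = (0, 0)"
    proof (rule ccontr)
      assume nz: "v \<noteq> (0, 0)"
      with v have "fst v \<noteq> 0"
        by (metis vsmul_def mult_zero_left)
      then have "proj_point v = proj_point (1, m)"
        using proj_point_vsmul v by metis
      with nz \<open>v \<in> U\<close> m show False
        unfolding linset_def by (metis DiffI image_eqI singletonD)
    qed
    with mem have "(\<forall>i<length vs. c i - d i \<in> subfield_of q) \<and> lin_comb (\<lambda>i. c i - d i) vs = (0, 0)"
      by (simp add: v_def)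
    then have "\<forall>i<length vs. c i - d i = 0"
      by (rule indep[unfolded lin_indep_over_def, THEN spec, THEN mp])
    then show "c = d"
      using c d len by (intro PiE_ext) auto
  qed
  have "card ((\<lambda>c. \<Sum>i<4. c i * e i) ` ?C) = card (UNIV :: 'a set)"
    using card_image[OF inj] by (simp add: card_PiE card_subfield card_field)
  then have onto: "(\<lambda>c. \<Sum>i<4. c i * e i) ` ?C = UNIV"
    by (intro card_subset_eq) auto
  have coord: "\<exists>c. (\<forall>i<4. fr (c i) = c i) \<and> s = (\<Sum>i<4. c i * e i)" for s
  proof -
    have "s \<in> (\<lambda>c. \<Sum>i<4. c i * e i) ` ?C"
      unfolding onto by simp
    then obtain c where "c \<in> ?C" "s = (\<Sum>i<4. c i * e i)"
      by (rule imageE)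
    then show ?thesis
      by (auto simp: PiE_iff mem_subfield_iff)
  qed
  \<comment> \<open>Interpolation by counting: evaluation of q-polynomials at the basis
    \<open>e\<close> is injective on coefficient quadruples, hence surjective.\<close>
  define \<Phi> where "\<Phi> = (\<lambda>(a0, a1, a2, a3).
    (qp a0 a1 a2 a3 (e 0), qp a0 a1 a2 a3 (e 1), qp a0 a1 a2 a3 (e 2), qp a0 a1 a2 a3 (e 3)))"
  have four: "i < 4 \<longleftrightarrow> i = 0 \<or> i = 1 \<or> i = 2 \<or> i = 3" for i :: nat
    by auto
  have "inj \<Phi>"
  proof (rule injI)
    fix a b
    assume eq: "\<Phi> a = \<Phi> b"
    obtain a0 a1 a2 a3 b0 b1 b2 b3 where ab: "a = (a0, a1, a2, a3)" "b = (b0, b1, b2, b3)"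
      by (cases a; cases b)
    from eq have e0: "qp (a0 - b0) (a1 - b1) (a2 - b2) (a3 - b3) (e i) = 0" if "i < 4" for i
      using that unfolding four by (auto simp: ab \<Phi>_def qp_def algebra_simps)
    have "qp (a0 - b0) (a1 - b1) (a2 - b2) (a3 - b3) s = 0" for s
    proof -
      obtain c where "\<forall>i<4. fr (c i) = c i" and s: "s = (\<Sum>i<4. c i * e i)"
        using coord by blast
      then show ?thesis
        unfolding s by (subst qp_linear_combination) (simp_all add: e0)
    qed
    then show "a = b"
      using qp_eq_0_imp_coeffs_0[of "a0 - b0" "a1 - b1" "a2 - b2" "a3 - b3"] by (simp add: ab)
  qed
  then have "surj \<Phi>"
    by (simp add: finite_UNIV_inj_surj)
  then obtain a where "\<Phi> a = (- fst (vs ! 0), - fst (vs ! 1), - fst (vs ! 2), - fst (vs ! 3))"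
    by (metis surjD)
  then obtain a0 a1 a2 a3 where
    "\<Phi> (a0, a1, a2, a3) = (- fst (vs ! 0), - fst (vs ! 1), - fst (vs ! 2), - fst (vs ! 3))"
    by (metis prod_cases4)
  then have a: "qp a0 a1 a2 a3 (e i) = - fst (vs ! i)" if "i < 4" for i
    using that unfolding four by (auto simp: \<Phi>_def)
  have key: "lin_comb c vs = (- qp a0 a1 a2 a3 (\<Sum>i<4. c i * e i),
      (\<Sum>i<4. c i * e i) - m * qp a0 a1 a2 a3 (\<Sum>i<4. c i * e i))"
    if "\<forall>i<4. fr (c i) = c i" for c
  proof -
    have "qp a0 a1 a2 a3 (\<Sum>i<4. c i * e i) = - fst (lin_comb c vs)"
      using that by (subst qp_linear_combination) (simp_all add: a lin_comb_def len sum_negf)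
    then show ?thesis
      unfolding lc[symmetric] by (simp add: prod_eq_iff)
  qed
  have "U = qp_graph m a0 a1 a2 a3"
  proof (intro set_eqI iffI)
    fix v
    assume "v \<in> U"
    then obtain c where "\<forall>i<4. fr (c i) = c i" "v = lin_comb c vs"
      unfolding span[symmetric] by (auto simp: span_over_def len mem_subfield_iff)
    then show "v \<in> qp_graph m a0 a1 a2 a3"
      by (simp add: key qp_graph_def)
  next
    fix v
    assume "v \<in> qp_graph m a0 a1 a2 a3"
    then obtain s where s: "v = (- qp a0 a1 a2 a3 s, s - m * qp a0 a1 a2 a3 s)"
      by (auto simp: qp_graph_def)
    obtain c where c: "\<forall>i<4. fr (c i) = c i" "s = (\<Sum>i<4. c i * e i)"
      using coord by blast
    then have "v = lin_comb c vs"
      by (simp add: key s)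
    then show "v \<in> U"
      using c unfolding span[symmetric] by (auto simp: span_over_def len mem_subfield_iff)
  qed
  then show ?thesis
    by blast
qed

end

section \<open>Maximum field of linearity and the equivalence\<close>

lemma max_lin_exp_ge:
  assumes "e dvd n" "n > 0" "is_subspace_over (subfield_of (q ^ e)) U"
  shows "e \<le> max_lin_exp q n U"
  unfolding max_lin_exp_def
proof (rule Greatest_le_nat)
  show "e dvd n \<and> (\<exists>X. is_subspace_over (subfield_of (q ^ e)) X \<and> linset X = linset U)"
    using assms by blast
  show "k \<le> n" if "k dvd n \<and> (\<exists>X. is_subspace_over (subfield_of (q ^ k)) X \<and> linset X = linset U)" for k
    using that assms(2) by (auto intro: dvd_imp_le)
qed

theorem mainTheorem19:
  fixes q :: nat and U W :: "('a::{field,finite} \<times> 'a) set"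
  assumes "\<exists>p k. prime p \<and> k > 0 \<and> q = p ^ k"
    and "card (UNIV :: 'a set) = q ^ 4"
    and "is_subspace_over (subfield_of q) U" and "has_dim_over (subfield_of q) U 4"
    and "is_subspace_over (subfield_of q) W" and "has_dim_over (subfield_of q) W 4"
    and "max_lin_exp q 4 U = 1"
  shows "linset U = linset W \<longleftrightarrow>
    (\<exists>l::'a. l \<noteq> 0 \<and> (W = scale_set l U \<or> W = scale_set l (perp q 4 U)))"
proof -
  interpret quartic_extension q "TYPE('a)"
    by (rule quartic_extension.intro) (rule assms)+
  obtain m where m: "proj_point (1, m) \<notin> linset U"
    using exists_point_not_in_linset[OF assms(4)] by blast
  obtain a0 a1 a2 a3 where U: "U = qp_graph m a0 a1 a2 a3"
    using subspace_is_graph[OF assms(4) m] by blast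
  have nz: "\<not> (a1 = 0 \<and> a3 = 0)"
  proof
    assume "a1 = 0 \<and> a3 = 0"
    then have "2 \<le> max_lin_exp q 4 U"
      using graph_subspace_q2 by (intro max_lin_exp_ge) (auto simp: U)
    then show False
      using assms(7) by simp
  qed
  show ?thesis
  proof
    assume eq: "linset U = linset W"
    \<comment> \<open>\<open>W\<close> misses the same point, so the same \<open>m\<close> serves
      for both graphs.\<close>
    then obtain b0 b1 b2 b3 where W: "W = qp_graph m b0 b1 b2 b3"
      using subspace_is_graph[OF assms(6)] m by metis
    have "slopes a0 a1 a2 a3 = slopes b0 b1 b2 b3"
      using eq unfolding U W linset_graph_eq_iff .
    from coeffs_of_equal_slopes[OF this nz] obtain l where "a0 = b0" "l \<noteq> 0"
      "b1 = a1 * l / fr l \<and> b2 = a2 * l / fr (fr l) \<and> b3 = a3 * l / fr (fr (fr l)) \<or>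
       b1 = fr a3 * l / fr l \<and> b2 = fr (fr a2) * l / fr (fr l)
         \<and> b3 = fr (fr (fr a1)) * l / fr (fr (fr l))"
      by blast
    then show "\<exists>l. l \<noteq> 0 \<and> (W = scale_set l U \<or> W = scale_set l (perp q 4 U))"
      unfolding U W perp_graph by (intro exI[of _ l]) (auto simp: scale_set_graph)
  next
    have "linset (perp q 4 U) = linset U"
      unfolding U perp_graph linset_graph_eq_iff by (rule slopes_adjoint)
    moreover assume "\<exists>l. l \<noteq> 0 \<and> (W = scale_set l U \<or> W = scale_set l (perp q 4 U))"
    ultimately show "linset U = linset W"
      using linset_scale_set by metis
  qed
qed

end
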